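(* Let $m\ge 2$, $n\ge 1$, let $\mathcal{A}\in\mathcal{T}(m,n)$ be a semi-symmetric strong M-tensor and let $b\in\mathbb{R}^n$ with $b>0$. Let $\{y_k\}$ be any infinite sequence generated by the Newton algorithm described in the context (run without termination). Then the convergence rate of $\{y_k\}$ is quadratic; that is, with $y^*=(x^* )^{[m-1]}$, where $x^*$ is the unique positive solution of $\mathcal{A}x^{m-1}=b$, the sequence $\{y_k\}$ converges to $y^*$ and there is a constant $C>0$ such that $\|y_{k+1}-y^*\|\le C\|y_k-y^*\|^2$ for all sufficiently large $k$.
   Context: Tensors. $\mathcal{T}(m,n)$ is the set of real $m$th-order $n$-dimensional tensors $\mathcal{A}=(a_{i_1i_2\ldots i_m})$, $1\le i_1,\ldots,i_m\le n$. For $x\in\mathbb{R}^n$ (or $\mathbb{C}^n$), $\mathcal{A}x^{m-1}$ is the vector with $(\mathcal{A}x^{m-1})_i=\sum_{i_2,\ldots,i_m=1}^n a_{ii_2\ldots i_m}x_{i_2}\cdots x_{i_m}$. $x^{[\alpha]}=(x_1^\alpha,\ldots,x_n^\alpha)^T$ whenever meaningful. $\mathcal{I}$ is the identity tensor ($a_{ii\ldots i}=1$, all other entries $0$). $\lambda\in\mathbb{C}$ is an eigenvalue of $\mathcal{B}$ if $\mathcal{B}x^{m-1}=\lambda x^{[m-1]}$ for some nonzero $x\in\mathbb{C}^n$; $\rho(\mathcal{B})$ is the maximal modulus of the eigenvalues. $\mathcal{A}$ is a strong M-tensor if $\mathcal{A}=s\mathcal{I}-\mathcal{B}$ with $\mathcal{B}$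 entrywise nonnegative and $s>\rho(\mathcal{B})$. $\mathcal{A}$ is semi-symmetric if for each $i$ the entries $a_{ii_2\ldots i_m}$ are invariant under permutations of $i_2,\ldots,i_m$. Vector inequalities are componentwise; $\mathbb{R}^n_+$ and $\mathbb{R}^n_{++}$ are the sets of nonnegative and of positive vectors; $\|\cdot\|$ is the Euclidean norm. Set-up. $f(y)=\mathcal{A}\big(y^{[\frac1{m-1}]}\big)^{m-1}-b$ for $y\in\mathbb{R}^n_+$, and $f'(y)$ is its Jacobian, for $y\in\mathbb{R}^n_{++}$. For $\epsilon\in(0,1)$, $\mathcal{F}_\epsilon=\{y\in\mathbb{R}^n_+:\ \mathcal{A}(y^{[\frac1{m-1}]})^{m-1}\ge\epsilon b\}$. Newton algorithm. Fix $\epsilon\in(0,1)$, $\sigma\in(0,\tfrac12)$, $\rho\in(0,1)$. Choose $y_0\in\mathcal{F}_\epsilon$. For $k=0,1,2,\ldots$: let $d_k$ be the solution of $f'(y_k)d_k+f(y_k)=0$; let $\alpha_k$ be the largest element of $\{\rho^i: i=0,1,2,\ldots\}$ such that $y_k+\alpha_kd_k\in\mathcal{F}_\epsilon$ and $\|f(y_k+\alpha_kd_k)\|^2\le(1-2\sigma\alpha_k)\|f(y_k)\|^2$; set $y_{k+1}=y_k+\alpha_kd_k$. *)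

theory Defs
  imports "HOL-Analysis.Analysis" "HOL-Library.Multiset"
begin

text \<open>
  A tensor of order \<open>m\<close> and dimension \<open>n = CARD('n)\<close> is given by its entries, indexed by lists
  \<open>[i\<^sub>1, \<dots>, i\<^sub>m]\<close> over the finite index type. Only the values on lists of length \<open>m\<close> are ever
  used, so the order is an explicit parameter of the notions below.
\<close>
type_synonym ('a, 'n) tensor = "'n list \<Rightarrow> 'a"

definition tensor_apply ::
    "nat \<Rightarrow> ('a::comm_semiring_1, 'n::finite) tensor \<Rightarrow> 'a ^ 'n \<Rightarrow> 'a ^ 'n" where
  "tensor_apply m A x =
     (\<chi> i. \<Sum>js\<in>{js. length js = m - 1}. A (i # js) * prod_list (map (\<lambda>j. x $ j) js))"

definition vec_power :: "'a::monoid_mult ^ 'n::finite \<Rightarrow> nat \<Rightarrow> 'a ^ 'n" where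
  "vec_power x k = (\<chi> i. x $ i ^ k)"

text \<open>Used for nonnegative vectors and positive exponents only.\<close>
definition vec_powr :: "real ^ 'n::finite \<Rightarrow> real \<Rightarrow> real ^ 'n" where
  "vec_powr x r = (\<chi> i. x $ i powr r)"

definition identity_tensor :: "(real, 'n) tensor" where
  "identity_tensor is = (if \<exists>i. is = replicate (length is) i then 1 else 0)"

definition tensor_eigenvalue :: "nat \<Rightarrow> (real, 'n::finite) tensor \<Rightarrow> complex \<Rightarrow> bool" where
  "tensor_eigenvalue m B l \<longleftrightarrow>
     (\<exists>x::complex ^ 'n. x \<noteq> 0 \<and>
        tensor_apply m (\<lambda>is. complex_of_real (B is)) x = l *s vec_power x (m - 1))"

text \<open>
  For \<open>m \<ge> 2\<close> the eigenvalues form a nonempty finite set (the roots of the characteristic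
  polynomial), so the supremum is the maximal modulus.
\<close>
definition tensor_spectral_radius :: "nat \<Rightarrow> (real, 'n::finite) tensor \<Rightarrow> real" where
  "tensor_spectral_radius m B = Sup {cmod l | l. tensor_eigenvalue m B l}"

definition strong_M_tensor :: "nat \<Rightarrow> (real, 'n::finite) tensor \<Rightarrow> bool" where
  "strong_M_tensor m A \<longleftrightarrow>
     (\<exists>s B. (\<forall>is. length is = m \<longrightarrow> A is = s * identity_tensor is - B is) \<and>
            (\<forall>is. length is = m \<longrightarrow> B is \<ge> 0) \<and>
            s > tensor_spectral_radius m B)"

text \<open>\<open>mset js = mset ks\<close> says that \<open>ks\<close> is a permutation of \<open>js\<close>.\<close>
definition semi_symmetric :: "nat \<Rightarrow> (real, 'n::finite) tensor \<Rightarrow> bool" where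
  "semi_symmetric m A \<longleftrightarrow>
     (\<forall>i js ks. length js = m - 1 \<longrightarrow> mset js = mset ks \<longrightarrow> A (i # js) = A (i # ks))"

definition newton_map ::
    "nat \<Rightarrow> (real, 'n::finite) tensor \<Rightarrow> real ^ 'n \<Rightarrow> real ^ 'n \<Rightarrow> real ^ 'n" where
  "newton_map m A b y = tensor_apply m A (vec_powr y (1 / (real m - 1))) - b"

text \<open>The order \<open>\<le>\<close> on \<open>real ^ 'n\<close> is componentwise.\<close>
definition newton_feasible ::
    "nat \<Rightarrow> (real, 'n::finite) tensor \<Rightarrow> real ^ 'n \<Rightarrow> real \<Rightarrow> (real ^ 'n) set" where
  "newton_feasible m A b \<epsilon> =
     {y. 0 \<le> y \<and> \<epsilon> *\<^sub>R b \<le> tensor_apply m A (vec_powr y (1 / (real m - 1)))}"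

definition newton_steps ::
    "nat \<Rightarrow> (real, 'n::finite) tensor \<Rightarrow> real ^ 'n \<Rightarrow> real \<Rightarrow> real \<Rightarrow> real \<Rightarrow>
     real ^ 'n \<Rightarrow> real ^ 'n \<Rightarrow> real set" where
  "newton_steps m A b \<epsilon> \<sigma> \<rho> y d =
     {\<alpha>. (\<exists>i::nat. \<alpha> = \<rho> ^ i) \<and>
          y + \<alpha> *\<^sub>R d \<in> newton_feasible m A b \<epsilon> \<and>
          (norm (newton_map m A b (y + \<alpha> *\<^sub>R d)))\<^sup>2
            \<le> (1 - 2 * \<sigma> * \<alpha>) * (norm (newton_map m A b y))\<^sup>2}"

text \<open>
  The infinite sequences generated by the algorithm. For a strong M-tensor and \<open>b > 0\<close>, every
  point of the feasible set is strictly positive, so \<^const>\<open>jacobian\<close> is only ever taken at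
  points where \<^const>\<open>newton_map\<close> is differentiable.
\<close>
definition newton_sequence ::
    "nat \<Rightarrow> (real, 'n::finite) tensor \<Rightarrow> real ^ 'n \<Rightarrow> real \<Rightarrow> real \<Rightarrow> real \<Rightarrow>
     (nat \<Rightarrow> real ^ 'n) \<Rightarrow> bool" where
  "newton_sequence m A b \<epsilon> \<sigma> \<rho> y \<longleftrightarrow>
     y 0 \<in> newton_feasible m A b \<epsilon> \<and>
     (\<forall>k. \<exists>d \<alpha>.
        jacobian (newton_map m A b) (at (y k)) *v d + newton_map m A b (y k) = 0 \<and>
        \<alpha> \<in> newton_steps m A b \<epsilon> \<sigma> \<rho> (y k) d \<and>
        (\<forall>\<beta>\<in>newton_steps m A b \<epsilon> \<sigma> \<rho> (y k) d. \<beta> \<le> \<alpha>) \<and>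
        y (Suc k) = y k + \<alpha> *\<^sub>R d)"

text \<open>Positivity is spelled out, since \<open><\<close> on \<open>real ^ 'n\<close> is not the componentwise strict order.\<close>
definition positive_solution ::
    "nat \<Rightarrow> (real, 'n::finite) tensor \<Rightarrow> real ^ 'n \<Rightarrow> real ^ 'n \<Rightarrow> bool" where
  "positive_solution m A b x \<longleftrightarrow> (\<forall>i. x $ i > 0) \<and> tensor_apply m A x = b"

end

theory Submission
  imports Defs
begin

text \<open>
  Write \<open>p = m - 1\<close> and \<open>A = s \<I> - B\<close> with \<open>B\<close> nonnegative. In the variable \<open>y = x\<^bsup>[p]\<^esup>\<close> the map of
  the tensor becomes \<open>g y = s y - G y\<close>, where each coordinate of \<open>G\<close> is a nonnegative combination of
  geometric means of \<open>p\<close> coordinates of \<open>y\<close>. So \<open>G\<close> is monotone, homogeneous of degree one and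
  concave, and its derivative \<open>D y\<close> satisfies Euler's identity \<open>D y y = G y\<close>. The inequality between
  geometric and arithmetic means, with a reverse inequality of second order, gives for the
  linearisation \<open>M y h = s h - D y h\<close>
    \<open>M y z \<le> g z \<le> M y z + O(norm (z - y)\<^sup>2)\<close>
  uniformly on boxes inside the positive orthant (\<open>g_ge_tangent\<close>, \<open>g_tangent_error\<close>). This also
  shows that \<open>M y\<close> is the derivative of \<open>g\<close>.

  A feasible point \<open>y\<close> satisfies \<open>M y y = g y \<ge> \<epsilon> b > 0\<close>, hence \<open>y > 0\<close>, and both \<open>g\<close> and the Z-matrix
  \<open>M y\<close> obey comparison principles (\<open>g_comparison\<close>, \<open>M_comparison\<close>). Semipositivity,
  the property of strong M-tensors on which these principles rest, is witnessed by the feasible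
  starting point itself, so that no Perron-Frobenius theory enters. The principles show that level sets of the
  residual are bounded, that the full Newton iterate is positive, that the Newton direction is
  bounded by a multiple of the residual, and that the error is bounded by a multiple of the residual.

  By convexity every step \<open>\<alpha> \<le> 1\<close> is feasible, and
    \<open>norm (g (y + \<alpha> d) - b) \<le> (1 - \<alpha>) r + c \<alpha>\<^sup>2 r\<^sup>2\<close> with \<open>r = norm (g y - b)\<close>
  and a uniform constant \<open>c\<close> (\<open>newton_residual_estimate\<close>). The sufficient decrease condition
  therefore accepts all \<open>\<alpha> \<le> 1\<close> with \<open>c r \<alpha> \<le> 1 - 2 \<sigma>\<close>. So the accepted steps are bounded below, the
  residuals tend to zero geometrically, the full step is eventually accepted, and from then on
  the residuals decrease quadratically. Residual and error are comparable near the solution, so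
  the errors decrease quadratically as well.
\<close>

section \<open>Geometric means\<close>

lemma prod_list_powr_eq_exp:
  fixes xs :: "real list"
  assumes "\<forall>x\<in>set xs. x > 0"
  shows "prod_list (map (\<lambda>x. x powr r) xs) = exp (r * sum_list (map ln xs))"
  using assms by (induction xs) (auto simp: powr_def exp_add algebra_simps)

lemma geometric_mean_le_arithmetic_mean:
  fixes xs :: "real list"
  assumes "\<forall>x\<in>set xs. x > 0" and "xs \<noteq> []"
  shows "prod_list (map (\<lambda>x. x powr (1 / real (length xs))) xs) \<le> sum_list xs / real (length xs)"
proof -
  define p where "p = real (length xs)"
  define a where "a = sum_list xs / p"
  have p: "p > 0" using assms(2) by (simp add: p_def)
  obtain x ys where xs: "xs = x # ys" using assms(2) by (cases xs) auto
  have "0 \<le> sum_list ys"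
    using assms(1) by (intro sum_list_nonneg) (auto simp: xs less_imp_le)
  then have "sum_list xs > 0"
    using assms(1) by (simp add: xs)
  then have a: "a > 0" using p by (simp add: a_def)
  have "sum_list (map ln ys) \<le> real (length ys) * ln a + sum_list ys / a - real (length ys)"
    if "\<forall>x\<in>set ys. x > 0" for ys
    using that
  proof (induction ys)
    case (Cons x ys)
    have "ln (x / a) \<le> x / a - 1"
      using Cons.prems a by (intro ln_le_minus_one) auto
    then have "ln x \<le> ln a + x / a - 1"
      using Cons.prems a by (simp add: ln_div)
    then show ?case
      using Cons by (simp add: algebra_simps add_divide_distrib)
  qed simp
  from this[OF assms(1)] have "sum_list (map ln xs) \<le> p * ln a"
    using p \<open>sum_list xs > 0\<close> by (simp add: p_def[symmetric] a_def)
  then have "1 / p * sum_list (map ln xs) \<le> ln a"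
    using p by (simp add: field_simps)
  then have "exp (1 / p * sum_list (map ln xs)) \<le> a"
    using a by (metis exp_le_cancel_iff exp_ln)
  then show ?thesis
    using prod_list_powr_eq_exp[OF assms(1), of "1 / p"] by (simp add: a_def p_def)
qed

text \<open>
  The reverse estimate: the defect of the inequality between the means is of second order in the
  deviations \<open>x - 1\<close>. It follows from \<open>exp t \<ge> 1 + t\<close> and \<open>ln x \<ge> 1 - 1 / x\<close>.
\<close>
lemma geometric_mean_ge_arithmetic_mean_minus:
  fixes xs :: "real list"
  assumes "\<forall>x\<in>set xs. x > 0" and "xs \<noteq> []" and "\<forall>x\<in>set xs. (x - 1)\<^sup>2 / x \<le> e"
  shows "sum_list xs / real (length xs) - e
           \<le> prod_list (map (\<lambda>x. x powr (1 / real (length xs))) xs)"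
proof -
  define p where "p = real (length xs)"
  have p: "p > 0" using assms(2) by (simp add: p_def)
  have "sum_list (map ln ys) \<ge> sum_list ys - real (length ys) - real (length ys) * e"
    if "\<forall>x\<in>set ys. x > 0" "\<forall>x\<in>set ys. (x - 1)\<^sup>2 / x \<le> e" for ys
    using that
  proof (induction ys)
    case (Cons x ys)
    have x: "x > 0" using Cons.prems by auto
    have "ln (1 / x) \<le> 1 / x - 1"
      using x by (intro ln_le_minus_one) auto
    then have "ln x \<ge> 1 - 1 / x"
      using x by (simp add: ln_div)
    moreover have "1 - 1 / x = x - 1 - (x - 1)\<^sup>2 / x"
      using x by (simp add: field_simps power2_eq_square)
    ultimately have "ln x \<ge> x - 1 - e"
      using Cons.prems by (smt (verit) list.set_intros(1))
    then show ?case
      using Cons by (simp add: algebra_simps)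
  qed simp
  from this[OF assms(1,3)] have "sum_list xs - p - p * e \<le> sum_list (map ln xs)"
    by (simp add: p_def)
  then have "(sum_list xs - p - p * e) / p \<le> sum_list (map ln xs) / p"
    using p by (intro divide_right_mono) auto
  then have "sum_list xs / p - 1 - e \<le> 1 / p * sum_list (map ln xs)"
    using p by (simp add: diff_divide_distrib)
  also have "\<dots> \<le> exp (1 / p * sum_list (map ln xs)) - 1"
    using exp_ge_add_one_self[of "1 / p * sum_list (map ln xs)"] by linarith
  finally show ?thesis
    using prod_list_powr_eq_exp[OF assms(1), of "1 / p"] by (simp add: p_def)
qed

section \<open>The map of a Z-tensor in the variable of powers\<close>

lemma finite_lists_of_length: "finite {js :: 'n::finite list. length js = k}"
  using finite_lists_length_eq[of "UNIV :: 'n set" k] by simp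

text \<open>
  \<open>B\<close> is a nonnegative tensor of order \<open>p + 1\<close>. In the variable \<open>y = x\<^bsup>[p]\<^esup>\<close> each monomial of \<open>B\<close>
  becomes a geometric mean of \<open>p\<close> coordinates of \<open>y\<close>.
\<close>
locale nonneg_tensor =
  fixes p :: nat and B :: "(real, 'n::finite) tensor" and s :: real
  assumes p_pos: "0 < p"
    and B_nonneg: "length is = Suc p \<Longrightarrow> 0 \<le> B is"
begin

text \<open>The geometric mean of the coordinates of \<open>y\<close> listed in \<open>js\<close>, when \<open>js\<close> has length \<open>p\<close>.\<close>
definition gmean :: "real ^ 'n \<Rightarrow> 'n list \<Rightarrow> real" where
  "gmean y js = prod_list (map (\<lambda>j. y $ j powr (1 / real p)) js)"

text \<open>For nonnegative \<open>y\<close>, the map \<open>y \<mapsto> B (y\<^bsup>[1/p]\<^esup>)\<^sup>p\<close>.\<close>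
definition G :: "real ^ 'n \<Rightarrow> real ^ 'n" where
  "G y = (\<chi> i. \<Sum>js\<in>{js. length js = p}. B (i # js) * gmean y js)"

text \<open>
  The derivative of \<open>G\<close> at a positive \<open>y\<close>, applied to \<open>h\<close>: the logarithmic derivative of a geometric
  mean is the arithmetic mean of the quotients \<open>h $ j / y $ j\<close>.
\<close>
definition D :: "real ^ 'n \<Rightarrow> real ^ 'n \<Rightarrow> real ^ 'n" where
  "D y h = (\<chi> i. \<Sum>js\<in>{js. length js = p}.
     B (i # js) * (gmean y js * (sum_list (map (\<lambda>j. h $ j / y $ j) js) / real p)))"

text \<open>The map of the tensor \<open>s \<I> - B\<close>, and its derivative.\<close>
definition g :: "real ^ 'n \<Rightarrow> real ^ 'n" where
  "g y = s *\<^sub>R y - G y"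

definition M :: "real ^ 'n \<Rightarrow> real ^ 'n \<Rightarrow> real ^ 'n" where
  "M y h = s *\<^sub>R h - D y h"

lemma gmean_nonneg: "0 \<le> gmean y js"
  by (auto simp: gmean_def intro!: prod_list_nonneg)

lemma G_nonneg: "0 \<le> G y $ i"
  unfolding G_def vec_lambda_beta
  by (intro sum_nonneg mult_nonneg_nonneg) (simp_all add: gmean_nonneg B_nonneg)

lemma gmean_mono:
  assumes "\<forall>j. 0 \<le> y $ j" "\<forall>j. y $ j \<le> z $ j"
  shows "gmean y js \<le> gmean z js"
proof (induction js)
  case (Cons j js)
  have "y $ j powr (1 / real p) \<le> z $ j powr (1 / real p)"
    using assms by (intro powr_mono2) auto
  then show ?case
    using Cons gmean_nonneg[of y js] by (auto simp: gmean_def intro!: mult_mono)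
qed (simp add: gmean_def)

lemma gmean_scale:
  assumes "\<forall>j. 0 \<le> y $ j" "0 \<le> t" "length js = p"
  shows "gmean (t *\<^sub>R y) js = t * gmean y js"
proof -
  have "gmean (t *\<^sub>R y) js = t powr (real (length js) / real p) * gmean y js" if "0 < t"
    using that assms(1)
    by (induction js) (auto simp: gmean_def powr_mult powr_add add_divide_distrib algebra_simps)
  moreover have "gmean (0 *\<^sub>R y) js = 0"
    using assms(3) p_pos by (cases js) (auto simp: gmean_def)
  ultimately show ?thesis
    using assms(2,3) p_pos by (cases "t = 0") auto
qed

lemma G_mono:
  assumes "\<forall>j. 0 \<le> y $ j" "\<forall>j. y $ j \<le> z $ j"
  shows "G y $ i \<le> G z $ i"
  unfolding G_def vec_lambda_beta
  by (intro sum_mono mult_left_mono gmean_mono assms) (simp add: B_nonneg)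

lemma G_scale:
  assumes "\<forall>j. 0 \<le> y $ j" "0 \<le> t"
  shows "G (t *\<^sub>R y) = t *\<^sub>R G y"
  by (simp add: G_def vec_eq_iff sum_distrib_left gmean_scale[OF assms] ac_simps)

lemma linear_D: "linear (D y)"
  by (rule linearI)
    (simp_all add: D_def vec_eq_iff sum_distrib_left sum_list_addf add_divide_distrib
      ring_distribs sum.distrib times_divide_eq_right[symmetric] sum_list_const_mult
      mult.left_commute del: times_divide_eq_right)

lemma linear_M: "linear (M y)"
  using linear_D[of y]
  by (auto simp: linear_iff M_def algebra_simps)

lemma D_mono:
  assumes "\<forall>j. 0 < y $ j" "\<forall>j. h $ j \<le> k $ j"
  shows "D y h $ i \<le> D y k $ i"
  unfolding D_def vec_lambda_beta
  by (intro sum_mono mult_left_mono divide_right_mono sum_list_mono)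
    (simp_all add: B_nonneg gmean_nonneg assms less_imp_le)

text \<open>Euler's identity for the homogeneous map \<open>G\<close>.\<close>
lemma D_self:
  assumes "\<forall>j. 0 < y $ j"
  shows "D y y = G y"
proof -
  have "sum_list (map (\<lambda>j. y $ j / y $ j) js) = real (length js)" for js
    using assms by (induction js) (auto simp: less_imp_neq[symmetric])
  then show ?thesis
    using p_pos by (simp add: D_def G_def vec_eq_iff)
qed

lemma M_self:
  assumes "\<forall>j. 0 < y $ j"
  shows "M y y = g y"
  by (simp add: M_def g_def D_self[OF assms])

lemma gmean_ratio:
  assumes "\<forall>j. 0 < y $ j" "\<forall>j. 0 < z $ j"
  shows "gmean z js =
    gmean y js * prod_list (map (\<lambda>x. x powr (1 / real p)) (map (\<lambda>j. z $ j / y $ j) js))"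
  using assms by (induction js) (auto simp: gmean_def powr_divide less_imp_le less_imp_neq[symmetric])

text \<open>\<open>G\<close> is concave: its graph lies below its tangents (which are homogeneous by Euler's identity).\<close>
lemma G_le_tangent:
  assumes "\<forall>j. 0 < y $ j" "\<forall>j. 0 < z $ j"
  shows "G z $ i \<le> D y z $ i"
  unfolding G_def D_def vec_lambda_beta
proof (intro sum_mono mult_left_mono)
  fix js :: "'n list" assume "js \<in> {js. length js = p}"
  then have js: "length js = p" "js \<noteq> []" using p_pos by auto
  then show "0 \<le> B (i # js)" by (simp add: B_nonneg)
  show "gmean z js \<le> gmean y js * (sum_list (map (\<lambda>j. z $ j / y $ j) js) / real p)"
    unfolding gmean_ratio[OF assms]
  proof (rule mult_left_mono)
    show "prod_list (map (\<lambda>x. x powr (1 / real p)) (map (\<lambda>j. z $ j / y $ j) js))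
            \<le> sum_list (map (\<lambda>j. z $ j / y $ j) js) / real p"
      using geometric_mean_le_arithmetic_mean[of "map (\<lambda>j. z $ j / y $ j) js"] assms js
      by (simp del: map_map)
  qed (rule gmean_nonneg)
qed

text \<open>The tangents overestimate \<open>G\<close> by a second order term only.\<close>
lemma G_ge_tangent_minus:
  assumes y: "\<forall>j. l \<le> y $ j" and z: "\<forall>j. l \<le> z $ j" and l: "0 < l"
  shows "D y z $ i - (norm (z - y))\<^sup>2 / l\<^sup>2 * G y $ i \<le> G z $ i"
proof -
  let ?N = "(norm (z - y))\<^sup>2 / l\<^sup>2"
  have pos: "\<forall>j. 0 < y $ j" "\<forall>j. 0 < z $ j"
    using assms by (auto intro: less_le_trans)
  have dev: "(z $ j / y $ j - 1)\<^sup>2 / (z $ j / y $ j) \<le> ?N" for j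
  proof -
    have "(z $ j / y $ j - 1)\<^sup>2 / (z $ j / y $ j) = (z $ j - y $ j)\<^sup>2 / (y $ j * z $ j)"
      using spec[OF pos(1), of j] spec[OF pos(2), of j]
      by (simp add: field_simps power2_eq_square)
    also have "\<dots> \<le> ?N"
    proof (rule frac_le)
      show "(z $ j - y $ j)\<^sup>2 \<le> (norm (z - y))\<^sup>2"
        using component_le_norm_cart[of "z - y" j]
        by (metis abs_le_square_iff abs_norm_cancel vector_minus_component)
      show "l\<^sup>2 \<le> y $ j * z $ j"
        using mult_mono[of l "y $ j" l "z $ j"] y z l pos by (simp add: power2_eq_square less_imp_le)
    qed (use l in auto)
    finally show ?thesis .
  qed
  have "(\<Sum>js\<in>{js. length js = p}. B (i # js) *
          (gmean y js * (sum_list (map (\<lambda>j. z $ j / y $ j) js) / real p - ?N))) \<le> G z $ i"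
    unfolding G_def vec_lambda_beta
  proof (intro sum_mono mult_left_mono)
    fix js :: "'n list" assume "js \<in> {js. length js = p}"
    then have js: "length js = p" "js \<noteq> []" using p_pos by auto
    then show "0 \<le> B (i # js)" by (simp add: B_nonneg)
    show "gmean y js * (sum_list (map (\<lambda>j. z $ j / y $ j) js) / real p - ?N) \<le> gmean z js"
      unfolding gmean_ratio[OF pos]
    proof (rule mult_left_mono)
      show "sum_list (map (\<lambda>j. z $ j / y $ j) js) / real p - ?N
              \<le> prod_list (map (\<lambda>x. x powr (1 / real p)) (map (\<lambda>j. z $ j / y $ j) js))"
        using geometric_mean_ge_arithmetic_mean_minus[of "map (\<lambda>j. z $ j / y $ j) js" ?N] pos js dev
        by (simp del: map_map)
    qed (rule gmean_nonneg)
  qed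
  then show ?thesis
    by (simp add: D_def G_def right_diff_distrib sum_subtractf sum_distrib_left ac_simps)
qed

lemma g_ge_tangent:
  assumes "\<forall>j. 0 < y $ j" "\<forall>j. 0 < z $ j"
  shows "M y z $ i \<le> g z $ i"
  using G_le_tangent[OF assms, of i] by (simp add: M_def g_def)

text \<open>The second order remainder of \<open>g\<close> at \<open>y\<close>; note that \<open>M y z = g y + M y (z - y)\<close> by Euler's identity.\<close>
lemma g_tangent_error:
  assumes y: "\<forall>j. l \<le> y $ j" and z: "\<forall>j. l \<le> z $ j" and l: "0 < l"
    and K: "\<forall>i. G y $ i \<le> K"
  shows "norm (g z - M y z) \<le> real CARD('n) * K / l\<^sup>2 * (norm (z - y))\<^sup>2"
proof -
  have pos: "\<forall>j. 0 < y $ j" "\<forall>j. 0 < z $ j"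
    using assms by (auto intro: less_le_trans)
  have "\<bar>(g z - M y z) $ i\<bar> \<le> K / l\<^sup>2 * (norm (z - y))\<^sup>2" for i
  proof -
    have "(g z - M y z) $ i = D y z $ i - G z $ i"
      by (simp add: M_def g_def)
    moreover have "(norm (z - y))\<^sup>2 / l\<^sup>2 * G y $ i \<le> (norm (z - y))\<^sup>2 / l\<^sup>2 * K"
      using K by (intro mult_left_mono) auto
    ultimately show ?thesis
      using G_le_tangent[OF pos, of i] G_ge_tangent_minus[OF y z l, of i]
      by (simp add: mult.commute)
  qed
  then have "(\<Sum>i\<in>UNIV. \<bar>(g z - M y z) $ i\<bar>) \<le> (\<Sum>i\<in>(UNIV::'n set). K / l\<^sup>2 * (norm (z - y))\<^sup>2)"
    by (intro sum_mono)
  also have "\<dots> = real CARD('n) * K / l\<^sup>2 * (norm (z - y))\<^sup>2"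
    by simp
  finally show ?thesis
    using norm_le_l1_cart[of "g z - M y z"] by linarith
qed

text \<open>The second order tangent estimate already yields differentiability.\<close>
lemma g_has_derivative:
  assumes y: "\<forall>j. 0 < y $ j"
  shows "(g has_derivative M y) (at y)"
  unfolding has_derivative_at_alt
proof (intro conjI allI impI)
  show "bounded_linear (M y)"
    using linear_M linear_conv_bounded_linear by blast
  \<comment> \<open>\<open>l\<close> bounds the coordinates from below on a whole neighbourhood of \<open>y\<close>.\<close>
  define l where "l = Min (range (($) y)) / 2"
  have l: "0 < l" using y by (simp add: l_def)
  have ly: "2 * l \<le> y $ j" for j by (simp add: l_def)
  define K where "K = Max (range (($) (G y)))"
  have K: "\<forall>i. G y $ i \<le> K" by (simp add: K_def)
  have K0: "0 \<le> K" using K G_nonneg[of y undefined] by (meson order_trans)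
  define C where "C = real CARD('n) * K / l\<^sup>2"
  have C: "0 \<le> C" using K0 by (simp add: C_def)
  fix e :: real assume e: "0 < e"
  define d where "d = min l (e / (C + 1))"
  have "norm (g z - g y - M y (z - y)) \<le> e * norm (z - y)" if z: "norm (z - y) < d" for z
  proof -
    have "\<bar>z $ j - y $ j\<bar> < l" for j
      using component_le_norm_cart[of "z - y" j] z by (simp add: d_def)
    then have lz: "\<forall>j. l \<le> z $ j"
      using ly by (smt (verit))
    have "\<forall>j. l \<le> y $ j" using ly l by (smt (verit))
    from g_tangent_error[OF this lz l K]
    have "norm (g z - M y z) \<le> C * (norm (z - y))\<^sup>2"
      by (simp add: C_def)
    moreover have "g z - g y - M y (z - y) = g z - M y z"
      using linear_diff[OF linear_M, of y z y] M_self[OF y] by simp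
    moreover have "C * norm (z - y) \<le> e"
    proof -
      have "norm (z - y) * (C + 1) \<le> e"
        using z C by (simp add: d_def less_divide_eq mult.commute)
      moreover have "C * norm (z - y) \<le> norm (z - y) * (C + 1)"
        by (simp add: distrib_left mult.commute[of C])
      ultimately show ?thesis by linarith
    qed
    then have "C * (norm (z - y))\<^sup>2 \<le> e * norm (z - y)"
      unfolding power2_eq_square mult.assoc[symmetric] by (intro mult_right_mono) auto
    ultimately show ?thesis by (simp only:)
  qed
  moreover have "0 < d" using l e C by (simp add: d_def)
  ultimately show "\<exists>d>0. \<forall>z. norm (z - y) < d \<longrightarrow> norm (g z - g y - M y (z - y)) \<le> e * norm (z - y)"
    by blast
qed

text \<open>
  Comparison principle for the linearisation: \<open>y\<close> is a positive vector with positive image, so the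
  Z-matrix \<open>M y\<close> is a nonsingular M-matrix.
\<close>
lemma M_comparison:
  assumes y: "\<forall>j. 0 < y $ j" and gy: "\<forall>i. 0 < g y $ i"
    and le: "\<forall>i. M y v $ i \<le> t * g y $ i"
  shows "v $ j \<le> t * y $ j"
proof (rule ccontr)
  assume neg: "\<not> v $ j \<le> t * y $ j"
  \<comment> \<open>\<open>v \<le> r y\<close> with equality at \<open>i\<close>, and \<open>D y\<close> is monotone.\<close>
  define r where "r = Max (range (\<lambda>j. v $ j / y $ j))"
  have "r \<in> range (\<lambda>j. v $ j / y $ j)" unfolding r_def by (intro Max_in) auto
  then obtain i where i: "r = v $ i / y $ i" by auto
  have "v $ k / y $ k \<le> r" for k by (simp add: r_def)
  then have le_r: "v $ k \<le> (r *\<^sub>R y) $ k" for k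
    using y by (simp add: field_simps)
  have "t < v $ j / y $ j" using neg y by (simp add: field_simps)
  also have "\<dots> \<le> r" by (simp add: r_def)
  finally have "t < r" .
  have "r * g y $ i = s * v $ i - D y (r *\<^sub>R y) $ i"
    using spec[OF y, of i] D_self[OF y]
    by (simp add: i g_def linear_scale[OF linear_D] algebra_simps)
  also have "\<dots> \<le> M y v $ i"
    using D_mono[OF y, of v "r *\<^sub>R y" i] le_r by (simp add: M_def)
  also have "\<dots> \<le> t * g y $ i" using le by simp
  finally show False using \<open>t < r\<close> gy by (meson mult_le_cancel_right_pos not_le)
qed

text \<open>The same principle for \<open>g\<close> itself.\<close>
lemma g_comparison:
  assumes y: "\<forall>j. 0 \<le> y $ j" and w: "\<forall>j. 0 < w $ j" and gw: "\<forall>i. 0 < g w $ i"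
    and t: "0 \<le> t" and le: "\<forall>i. g y $ i \<le> t * g w $ i"
  shows "y $ j \<le> t * w $ j"
proof (rule ccontr)
  assume neg: "\<not> y $ j \<le> t * w $ j"
  define r where "r = Max (range (\<lambda>j. y $ j / w $ j))"
  have "r \<in> range (\<lambda>j. y $ j / w $ j)" unfolding r_def by (intro Max_in) auto
  then obtain i where i: "r = y $ i / w $ i" by auto
  have "y $ k / w $ k \<le> r" for k by (simp add: r_def)
  then have le_r: "y $ k \<le> (r *\<^sub>R w) $ k" for k
    using w by (simp add: field_simps)
  have "t < y $ j / w $ j" using neg w by (simp add: field_simps)
  also have "\<dots> \<le> r" by (simp add: r_def)
  finally have "t < r" .
  have w0: "\<forall>j. 0 \<le> w $ j" using w by (simp add: less_imp_le)
  have "r * g w $ i = s * y $ i - G (r *\<^sub>R w) $ i"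
    using spec[OF w, of i] G_scale[OF w0, of r] \<open>t < r\<close> t
    by (simp add: i g_def algebra_simps)
  also have "\<dots> \<le> g y $ i"
    using G_mono[OF y, of "r *\<^sub>R w" i] le_r by (simp add: g_def)
  also have "\<dots> \<le> t * g w $ i" using le by simp
  finally show False using \<open>t < r\<close> gw by (meson mult_le_cancel_right_pos not_le)
qed

end

text \<open>The sufficient decrease condition holds for every step that is short relative to the residual.\<close>
lemma armijo_condition:
  fixes a c N \<alpha> \<sigma> :: real
  assumes "0 \<le> a" "0 \<le> c" "0 \<le> N" "0 \<le> \<alpha>" "\<alpha> \<le> 1" "0 < \<sigma>"
    and N: "N \<le> (1 - \<alpha>) * a + c * \<alpha>\<^sup>2 * a\<^sup>2"
    and short: "c * a * \<alpha> \<le> 1 - 2 * \<sigma>"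
  shows "N\<^sup>2 \<le> (1 - 2 * \<sigma> * \<alpha>) * a\<^sup>2"
proof -
  define q where "q = 1 - \<alpha> + c * a * \<alpha> * \<alpha>"
  have "0 \<le> q" using assms by (simp add: q_def)
  have "c * a * \<alpha> * \<alpha> \<le> (1 - 2 * \<sigma>) * \<alpha>"
    using short assms(4) by (rule mult_right_mono)
  then have q: "q \<le> 1 - 2 * \<sigma> * \<alpha>" by (simp add: q_def algebra_simps)
  have "0 \<le> \<sigma> * \<alpha>" using assms by simp
  then have "q \<le> 1" using q by linarith
  have "N \<le> q * a" using N by (simp add: q_def algebra_simps power2_eq_square)
  then have "N\<^sup>2 \<le> (q * a)\<^sup>2" using assms(3) by (intro power_mono)
  also have "\<dots> = (q * q) * a\<^sup>2" by (simp add: power2_eq_square)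
  also have "\<dots> \<le> q * a\<^sup>2"
    using \<open>0 \<le> q\<close> \<open>q \<le> 1\<close> by (intro mult_right_mono) (auto simp: mult_left_le)
  also have "\<dots> \<le> (1 - 2 * \<sigma> * \<alpha>) * a\<^sup>2"
    using q by (intro mult_right_mono) auto
  finally show ?thesis .
qed

lemma norm_le_of_componentwise:
  fixes x w :: "real ^ 'n"
  assumes "\<And>j. \<bar>x $ j\<bar> \<le> t * w $ j" "0 \<le> t"
  shows "norm x \<le> t * norm w"
proof -
  have "norm x \<le> norm (t *\<^sub>R w)"
    using assms by (intro norm_le_componentwise_cart) (auto intro: order_trans[OF _ abs_ge_self])
  then show ?thesis using assms(2) by simp
qed

section \<open>Newton steps on the feasible set\<close>

text \<open>
  The M-tensor property enters through the feasible set \<open>F\<close> defined below: any point of \<open>F\<close> is a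
  positive vector with positive image under \<open>g\<close>, which is what the comparison principles ask for.
\<close>
locale newton_setting = nonneg_tensor p B s
  for p :: nat and B :: "(real, 'n::finite) tensor" and s :: real +
  fixes b :: "real ^ 'n" and \<epsilon> :: real
  assumes b_pos: "\<forall>i. 0 < b $ i" and eps_pos: "0 < \<epsilon>" and eps_less: "\<epsilon> < 1"
begin

text \<open>The feasible set in terms of \<open>g\<close>.\<close>
definition F :: "(real ^ 'n) set" where
  "F = {y. (\<forall>i. 0 \<le> y $ i) \<and> (\<forall>i. \<epsilon> * b $ i \<le> g y $ i)}"

text \<open>The smallest coordinate of \<open>b\<close>.\<close>
definition bmin :: real where
  "bmin = Min (range (($) b))"

lemma bmin_pos: "0 < bmin"
  using b_pos by (simp add: bmin_def)

lemma bmin_le: "bmin \<le> b $ i"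
  by (simp add: bmin_def)

lemma F_image_pos:
  assumes "y \<in> F"
  shows "\<forall>i. 0 < g y $ i"
  using assms b_pos eps_pos unfolding F_def by (force intro: less_le_trans[OF mult_pos_pos])

lemma F_lower:
  assumes "y \<in> F"
  shows "\<epsilon> * b $ i \<le> s * y $ i"
proof -
  have "\<epsilon> * b $ i \<le> g y $ i" using assms by (simp add: F_def)
  then show ?thesis using G_nonneg[of y i] by (simp add: g_def)
qed

lemma F_s_pos:
  assumes "y \<in> F"
  shows "0 < s"
proof -
  have "0 < s * y $ undefined"
    using F_lower[OF assms, of undefined] b_pos eps_pos by (meson less_le_trans mult_pos_pos)
  moreover have "0 \<le> y $ undefined" using assms by (simp add: F_def)
  ultimately show ?thesis by (simp add: zero_less_mult_iff)
qed

lemma F_ge: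
  assumes "y \<in> F"
  shows "\<forall>j. \<epsilon> * bmin / s \<le> y $ j"
proof
  fix j
  have "\<epsilon> * bmin \<le> s * y $ j"
    using F_lower[OF assms, of j] mult_left_mono[OF bmin_le[of j], of \<epsilon>] eps_pos by linarith
  then show "\<epsilon> * bmin / s \<le> y $ j"
    using F_s_pos[OF assms] by (simp add: divide_le_eq mult.commute)
qed

lemma F_pos:
  assumes "y \<in> F"
  shows "\<forall>j. 0 < y $ j"
proof -
  have "0 < \<epsilon> * bmin / s" using eps_pos bmin_pos F_s_pos[OF assms] by simp
  then show ?thesis using F_ge[OF assms] by (meson less_le_trans)
qed

lemma residual_component:
  "\<bar>g y $ i - b $ i\<bar> \<le> norm (g y - b) / bmin * b $ i"
proof -
  have "\<bar>g y $ i - b $ i\<bar> \<le> norm (g y - b)"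
    using component_le_norm_cart[of "g y - b" i] by simp
  also have "\<dots> = norm (g y - b) / bmin * bmin" using bmin_pos by simp
  also have "\<dots> \<le> norm (g y - b) / bmin * b $ i"
    using bmin_pos bmin_le by (intro mult_left_mono) auto
  finally show ?thesis .
qed

text \<open>The level sets of the residual in \<open>F\<close> are bounded, by comparison with a multiple of one point.\<close>
lemma F_level_bound:
  assumes y: "y \<in> F" and w: "w \<in> F" and \<phi>: "norm (g y - b) \<le> \<phi>"
  shows "norm y \<le> (1 + \<phi> / bmin) / \<epsilon> * norm w"
proof (rule norm_le_of_componentwise)
  let ?t = "(1 + \<phi> / bmin) / \<epsilon>"
  have "0 \<le> \<phi>" using \<phi> norm_ge_zero order_trans by blast
  then show t: "0 \<le> ?t" using bmin_pos eps_pos by simp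
  fix j
  have "g y $ i \<le> ?t * g w $ i" for i
  proof -
    have "g y $ i \<le> (1 + norm (g y - b) / bmin) * b $ i"
      using residual_component[of y i] by (simp add: algebra_simps)
    also have "\<dots> \<le> (1 + \<phi> / bmin) * b $ i"
      using \<phi> bmin_pos b_pos by (intro mult_right_mono) (auto simp: divide_right_mono less_imp_le)
    also have "\<dots> = ?t * (\<epsilon> * b $ i)" using eps_pos by simp
    also have "\<dots> \<le> ?t * g w $ i"
      using w t by (intro mult_left_mono) (auto simp: F_def)
    finally show ?thesis .
  qed
  then have "y $ j \<le> ?t * w $ j"
    using y t by (intro g_comparison F_pos[OF w] F_image_pos[OF w]) (auto simp: F_def)
  then show "\<bar>y $ j\<bar> \<le> ?t * w $ j" using F_pos[OF y] by (simp add: less_imp_le)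
qed

text \<open>The residual bounds the error, again by comparison with multiples of the solution.\<close>
lemma error_le_residual:
  assumes y: "y \<in> F" and w: "w \<in> F" and gw: "g w = b"
  shows "norm (y - w) \<le> norm (g y - b) / bmin * norm w"
proof (rule norm_le_of_componentwise)
  let ?t = "norm (g y - b) / bmin"
  show t: "0 \<le> ?t" using bmin_pos by simp
  fix j
  have yj: "0 < y $ j" and wj: "0 < w $ j" using F_pos y w by auto
  have "\<forall>i. g y $ i \<le> (1 + ?t) * g w $ i"
    using residual_component[of y] by (simp add: gw algebra_simps abs_le_iff)
  then have "y $ j \<le> (1 + ?t) * w $ j"
    using y t by (intro g_comparison F_pos[OF w] F_image_pos[OF w]) (auto simp: F_def)
  moreover have "(1 - ?t) * w $ j \<le> y $ j"
  proof (cases "?t < 1")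
    case True
    have "(1 - ?t) * b $ i \<le> g y $ i" for i
      using residual_component[of y i] by (simp add: algebra_simps abs_le_iff)
    then have "\<forall>i. g w $ i \<le> 1 / (1 - ?t) * g y $ i"
      using True by (simp add: gw le_divide_eq mult.commute)
    then have "w $ j \<le> 1 / (1 - ?t) * y $ j"
      using w True by (intro g_comparison F_pos[OF y] F_image_pos[OF y]) (auto simp: F_def)
    then show ?thesis using True by (simp add: le_divide_eq mult.commute)
  next
    case False
    then have "(1 - ?t) * w $ j \<le> 0" using wj by (intro mult_nonpos_nonneg) auto
    then show ?thesis using yj by linarith
  qed
  ultimately show "\<bar>(y - w) $ j\<bar> \<le> ?t * w $ j"
    by (simp add: algebra_simps abs_le_iff)
qed

text \<open>
  The full Newton iterate solves a linear system with a nonsingular M-matrix and right-hand side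
  \<open>b\<close>, hence is positive.
\<close>
lemma newton_iterate_pos:
  assumes y: "y \<in> F" and d: "M y d = b - g y"
  shows "0 < (y + d) $ j"
proof -
  have Myd: "M y (y + d) = b"
    using d by (simp add: linear_add[OF linear_M] M_self[OF F_pos[OF y]])
  have "M y (- (y + d)) = - b"
    using linear_neg[OF linear_M, of y "y + d"] Myd by simp
  then have "(- (y + d)) $ k \<le> 0 * y $ k" for k
    using b_pos by (intro M_comparison F_pos[OF y] F_image_pos[OF y]) (auto simp: less_imp_le)
  then have "0 \<le> (y + d) $ k" for k
    by (simp only: vector_uminus_component mult_zero_left neg_le_0_iff_le)
  then have "\<forall>k. (0 :: real ^ 'n) $ k \<le> (y + d) $ k" by simp
  from D_mono[OF F_pos[OF y] this, of j] have "0 \<le> D y (y + d) $ j"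
    by (simp add: linear_0[OF linear_D])
  moreover have "s * (y + d) $ j - D y (y + d) $ j = b $ j"
    using arg_cong[OF Myd, of "\<lambda>v. v $ j"] by (simp add: M_def)
  ultimately have "0 < s * (y + d) $ j"
    using b_pos by (smt (verit))
  then show ?thesis using F_s_pos[OF y] by (simp add: zero_less_mult_iff)
qed

text \<open>On the line in the Newton direction the linearised residual scales by \<open>1 - \<alpha>\<close>.\<close>
lemma M_newton_point:
  assumes y: "y \<in> F" and d: "M y d = b - g y"
  shows "M y (y + \<alpha> *\<^sub>R d) - b = (1 - \<alpha>) *\<^sub>R (g y - b)"
  by (simp add: linear_add[OF linear_M] linear_scale[OF linear_M] M_self[OF F_pos[OF y]] d
      scaleR_diff_left scaleR_diff_right)

text \<open>
  Hence no step of length at most \<open>1\<close> leaves \<open>F\<close>: by convexity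
  \<open>g (y + \<alpha> d) \<ge> (1 - \<alpha>) g y + \<alpha> b \<ge> \<epsilon> b\<close>.
\<close>
lemma newton_step_feasible:
  assumes y: "y \<in> F" and d: "M y d = b - g y" and \<alpha>: "0 \<le> \<alpha>" "\<alpha> \<le> 1"
  shows "y + \<alpha> *\<^sub>R d \<in> F"
proof -
  let ?z = "y + \<alpha> *\<^sub>R d"
  have pos: "0 < ?z $ j" for j
  proof -
    have "?z $ j = (1 - \<alpha>) * y $ j + \<alpha> * (y + d) $ j" by (simp add: algebra_simps)
    moreover have "0 < y $ j" "0 < (y + d) $ j"
      using F_pos[OF y] newton_iterate_pos[OF y d] by auto
    ultimately show ?thesis
      using \<alpha> by (cases "\<alpha> = 0") (auto intro!: add_nonneg_pos simp del: vector_add_component)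
  qed
  have "\<epsilon> * b $ i \<le> g ?z $ i" for i
  proof -
    have "\<epsilon> * b $ i \<le> g y $ i" using y by (simp add: F_def)
    have "\<epsilon> * b $ i \<le> b $ i" using eps_less b_pos by (simp add: mult_le_cancel_right1)
    then have "\<alpha> * (\<epsilon> * b $ i) \<le> \<alpha> * b $ i" using \<alpha> by (intro mult_left_mono)
    moreover have "(1 - \<alpha>) * (\<epsilon> * b $ i) \<le> (1 - \<alpha>) * g y $ i"
      using \<open>\<epsilon> * b $ i \<le> g y $ i\<close> \<alpha> by (intro mult_left_mono) auto
    moreover have "M y ?z $ i = (1 - \<alpha>) * g y $ i + \<alpha> * b $ i"
      using arg_cong[OF M_newton_point[OF y d, of \<alpha>], of "\<lambda>v. v $ i"] by (simp add: algebra_simps)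
    moreover have "M y ?z $ i \<le> g ?z $ i"
      using F_pos[OF y] pos by (intro g_ge_tangent) auto
    ultimately show ?thesis by (simp add: algebra_simps)
  qed
  then show ?thesis using pos by (simp add: F_def less_imp_le)
qed

lemma newton_direction_bound:
  assumes y: "y \<in> F" and d: "M y d = b - g y"
  shows "norm d \<le> norm (g y - b) / (bmin * \<epsilon>) * norm y"
proof (rule norm_le_of_componentwise)
  let ?t = "norm (g y - b) / (bmin * \<epsilon>)"
  show t: "0 \<le> ?t" using bmin_pos eps_pos by simp
  fix j
  have bound: "\<bar>g y $ i - b $ i\<bar> \<le> ?t * g y $ i" for i
  proof -
    have "\<bar>g y $ i - b $ i\<bar> \<le> ?t * (\<epsilon> * b $ i)"
      using residual_component[of y i] eps_pos by simp
    also have "\<dots> \<le> ?t * g y $ i"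
      using y t by (intro mult_left_mono) (auto simp: F_def)
    finally show ?thesis .
  qed
  have "d $ j \<le> ?t * y $ j"
    using bound by (intro M_comparison F_pos[OF y] F_image_pos[OF y]) (simp add: d abs_le_iff)
  moreover have "(- d) $ j \<le> ?t * y $ j"
    using bound by (intro M_comparison F_pos[OF y] F_image_pos[OF y])
      (simp add: d linear_neg[OF linear_M] abs_le_iff)
  ultimately show "\<bar>d $ j\<bar> \<le> ?t * y $ j" by (simp add: abs_le_iff)
qed

text \<open>
  The constant \<open>c\<close> is uniform on the level set \<open>norm (g y - b) \<le> \<phi>\<close>. It combines the tangent error
  of \<open>g\<close>, on the box given by the bounds on that level set, with the bound on \<open>d\<close> by the residual.
\<close>
lemma newton_residual_estimate:
  assumes w: "w \<in> F" and \<phi>: "0 \<le> \<phi>"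
  shows "\<exists>c\<ge>0. \<forall>y\<in>F. \<forall>d \<alpha>. norm (g y - b) \<le> \<phi> \<longrightarrow> M y d = b - g y \<longrightarrow> 0 \<le> \<alpha> \<longrightarrow> \<alpha> \<le> 1 \<longrightarrow>
           norm (g (y + \<alpha> *\<^sub>R d) - b) \<le> (1 - \<alpha>) * norm (g y - b) + c * \<alpha>\<^sup>2 * (norm (g y - b))\<^sup>2"
proof -
  define U where "U = (1 + \<phi> / bmin) / \<epsilon> * norm w"
  define l where "l = \<epsilon> * bmin / s"
  define c1 where "c1 = real CARD('n) * (s * U) / l\<^sup>2"
  define c where "c = c1 * (U / (bmin * \<epsilon>))\<^sup>2"
  have s: "0 < s" using F_s_pos[OF w] .
  have l: "0 < l" using s eps_pos bmin_pos by (simp add: l_def)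
  have U: "0 \<le> U" using \<phi> bmin_pos eps_pos by (simp add: U_def)
  have c1: "0 \<le> c1" using s U by (simp add: c1_def)
  have "norm (g (y + \<alpha> *\<^sub>R d) - b) \<le> (1 - \<alpha>) * norm (g y - b) + c * \<alpha>\<^sup>2 * (norm (g y - b))\<^sup>2"
    if y: "y \<in> F" and res: "norm (g y - b) \<le> \<phi>" and d: "M y d = b - g y"
      and \<alpha>: "0 \<le> \<alpha>" "\<alpha> \<le> 1" for y d \<alpha>
  proof -
    let ?z = "y + \<alpha> *\<^sub>R d"
    have yU: "norm y \<le> U"
      using F_level_bound[OF y w res] by (simp add: U_def)
    have K: "\<forall>i. G y $ i \<le> s * U"
    proof
      fix i
      have "G y $ i \<le> s * y $ i" using F_image_pos[OF y] by (simp add: g_def less_imp_le)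
      also have "\<dots> \<le> s * U"
        using component_le_norm_cart[of y i] yU s by (intro mult_left_mono) auto
      finally show "G y $ i \<le> s * U" .
    qed
    have z: "?z \<in> F" using newton_step_feasible[OF y d \<alpha>] .
    have "norm d \<le> norm (g y - b) / (bmin * \<epsilon>) * norm y"
      using newton_direction_bound[OF y d] .
    also have "\<dots> \<le> norm (g y - b) / (bmin * \<epsilon>) * U"
      using yU bmin_pos eps_pos by (intro mult_left_mono) auto
    finally have "norm d \<le> U / (bmin * \<epsilon>) * norm (g y - b)" by (simp add: mult.commute)
    then have "(norm d)\<^sup>2 \<le> (U / (bmin * \<epsilon>) * norm (g y - b))\<^sup>2"
      by (intro power_mono) auto
    then have "c1 * (\<alpha>\<^sup>2 * (norm d)\<^sup>2) \<le> c1 * (\<alpha>\<^sup>2 * (U / (bmin * \<epsilon>) * norm (g y - b))\<^sup>2)"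
      using c1 by (intro mult_left_mono) auto
    also have "\<dots> = c * \<alpha>\<^sup>2 * (norm (g y - b))\<^sup>2"
      unfolding c_def power_mult_distrib by (simp only: ac_simps)
    finally have quad: "c1 * (\<alpha>\<^sup>2 * (norm d)\<^sup>2) \<le> c * \<alpha>\<^sup>2 * (norm (g y - b))\<^sup>2" .
    have "norm (g ?z - M y ?z) \<le> c1 * (norm (?z - y))\<^sup>2"
      using g_tangent_error[OF F_ge[OF y] F_ge[OF z] l[unfolded l_def] K] by (simp add: c1_def l_def)
    also have "\<dots> = c1 * (\<alpha>\<^sup>2 * (norm d)\<^sup>2)"
      using \<alpha> by (simp add: power_mult_distrib)
    also note quad
    finally have err: "norm (g ?z - M y ?z) \<le> c * \<alpha>\<^sup>2 * (norm (g y - b))\<^sup>2" .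
    have "g ?z - b = (M y ?z - b) + (g ?z - M y ?z)" by simp
    also have "\<dots> = (1 - \<alpha>) *\<^sub>R (g y - b) + (g ?z - M y ?z)"
      by (simp only: M_newton_point[OF y d])
    also have "norm \<dots> \<le> norm ((1 - \<alpha>) *\<^sub>R (g y - b)) + norm (g ?z - M y ?z)"
      by (rule norm_triangle_ineq)
    finally show ?thesis using err \<alpha> by simp
  qed
  moreover have "0 \<le> c" using c1 by (simp add: c_def)
  ultimately show ?thesis by blast
qed

end

section \<open>Convergence of the damped Newton iteration\<close>

context newton_setting
begin

text \<open>The step lengths admitted by the backtracking rule at \<open>y\<close> in direction \<open>d\<close>.\<close>
definition armijo_steps :: "real \<Rightarrow> real \<Rightarrow> real ^ 'n \<Rightarrow> real ^ 'n \<Rightarrow> real set" where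
  "armijo_steps \<sigma> \<rho> y d =
     {\<alpha>. (\<exists>i::nat. \<alpha> = \<rho> ^ i) \<and> y + \<alpha> *\<^sub>R d \<in> F \<and>
          (norm (g (y + \<alpha> *\<^sub>R d) - b))\<^sup>2 \<le> (1 - 2 * \<sigma> * \<alpha>) * (norm (g y - b))\<^sup>2}"

text \<open>
  Points of \<open>F\<close> stay away from the boundary of the orthant, so \<open>g\<close> is continuous at their limits.
\<close>
lemma F_limit:
  assumes y: "\<And>k. y k \<in> F" and lim: "y \<longlonglongrightarrow> w" and res: "(\<lambda>k. norm (g (y k) - b)) \<longlonglongrightarrow> 0"
  shows "w \<in> F" "g w = b"
proof -
  have "0 < \<epsilon> * bmin / s" using eps_pos bmin_pos F_s_pos[OF y[of 0]] by simp
  moreover have "\<epsilon> * bmin / s \<le> w $ j" for j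
    using F_ge[OF y] by (intro LIMSEQ_le_const[OF tendsto_vec_nth[OF lim]]) auto
  ultimately have w: "\<forall>j. 0 < w $ j" by (meson less_le_trans)
  have "isCont g w"
    using has_derivative_continuous[OF g_has_derivative[OF w]] .
  then have "(\<lambda>k. g (y k)) \<longlonglongrightarrow> g w"
    using lim by (rule isCont_tendsto_compose)
  moreover have "(\<lambda>k. g (y k)) \<longlonglongrightarrow> b"
    using res by (simp add: tendsto_norm_zero_iff LIM_zero_iff)
  ultimately show gw: "g w = b" by (rule LIMSEQ_unique)
  show "w \<in> F"
    using w eps_less b_pos by (simp add: F_def gw less_imp_le mult_le_cancel_right1)
qed

text \<open>Near a solution the residual is at most a multiple of the error, as \<open>g\<close> is differentiable there.\<close>
lemma residual_le_error:
  assumes w: "w \<in> F" and gw: "g w = b"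
  shows "\<exists>L\<ge>0. \<exists>\<delta>>0. \<forall>y. norm (y - w) < \<delta> \<longrightarrow> norm (g y - b) \<le> L * norm (y - w)"
proof -
  have der: "(g has_derivative M w) (at w)"
    using g_has_derivative[OF F_pos[OF w]] .
  then obtain \<delta> where \<delta>: "0 < \<delta>"
    "\<And>y. norm (y - w) < \<delta> \<Longrightarrow> norm (g y - g w - M w (y - w)) \<le> 1 * norm (y - w)"
    unfolding has_derivative_at_alt by (meson zero_less_one)
  obtain K where K: "0 \<le> K" "\<And>v. norm (M w v) \<le> norm v * K"
    using bounded_linear.nonneg_bounded[OF has_derivative_bounded_linear[OF der]] by blast
  have "norm (g y - b) \<le> (K + 1) * norm (y - w)" if "norm (y - w) < \<delta>" for y
  proof -
    have "norm (g y - b) \<le> norm (g y - g w - M w (y - w)) + norm (M w (y - w))"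
      using norm_triangle_ineq[of "g y - g w - M w (y - w)" "M w (y - w)"] by (simp add: gw)
    then show ?thesis
      using \<delta>(2)[OF that] K(2)[of "y - w"] by (simp add: algebra_simps)
  qed
  then show ?thesis using K(1) \<delta>(1) by (intro exI[of _ "K + 1"]) auto
qed

text \<open>
  The existence of a solution of \<open>g w = b\<close> is part of the conclusion: every limit point of the
  iterates is one.
\<close>
theorem newton_converges_quadratically:
  fixes y :: "nat \<Rightarrow> real ^ 'n"
  assumes \<sigma>: "0 < \<sigma>" "\<sigma> < 1 / 2" and \<rho>: "0 < \<rho>" "\<rho> < 1"
    and y0: "y 0 \<in> F"
    and step: "\<And>k. y k \<in> F \<Longrightarrow> \<exists>d \<alpha>. M (y k) d = b - g (y k) \<and>
      \<alpha> \<in> armijo_steps \<sigma> \<rho> (y k) d \<and> (\<forall>\<beta>\<in>armijo_steps \<sigma> \<rho> (y k) d. \<beta> \<le> \<alpha>) \<and>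
      y (Suc k) = y k + \<alpha> *\<^sub>R d"
  shows "\<exists>w\<in>F. g w = b \<and> y \<longlonglongrightarrow> w \<and>
    (\<exists>C>0. \<forall>\<^sub>F k in sequentially. norm (y (Suc k) - w) \<le> C * (norm (y k - w))\<^sup>2)"
proof -
  define r where "r k = norm (g (y k) - b)" for k
  have r0: "0 \<le> r k" for k by (simp add: r_def)
  have yF: "y k \<in> F" for k
  proof (induction k)
    case (Suc k)
    then show ?case using step[OF Suc] by (auto simp: armijo_steps_def)
  qed (rule y0)
  obtain d \<alpha> where d: "\<And>k. M (y k) (d k) = b - g (y k)"
    and \<alpha>: "\<And>k. \<alpha> k \<in> armijo_steps \<sigma> \<rho> (y k) (d k)"
    and max: "\<And>k \<beta>. \<beta> \<in> armijo_steps \<sigma> \<rho> (y k) (d k) \<Longrightarrow> \<beta> \<le> \<alpha> k"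
    and next_y: "\<And>k. y (Suc k) = y k + \<alpha> k *\<^sub>R d k"
    using step[OF yF] by metis
  have pow: "0 < \<rho> ^ i \<and> \<rho> ^ i \<le> 1" for i
    using \<rho> by (simp add: power_le_one)
  have \<alpha>01: "0 < \<alpha> k" "\<alpha> k \<le> 1" for k
    using \<alpha>[of k] pow by (auto simp: armijo_steps_def)
  have decr: "(r (Suc k))\<^sup>2 \<le> (1 - 2 * \<sigma> * \<alpha> k) * (r k)\<^sup>2" for k
    using \<alpha>[of k] by (simp add: armijo_steps_def r_def next_y)
  have r_le: "r k \<le> r 0" for k
  proof (induction k)
    case (Suc k)
    have "(1 - 2 * \<sigma> * \<alpha> k) * (r k)\<^sup>2 \<le> 1 * (r k)\<^sup>2"
      using \<sigma> \<alpha>01[of k] by (intro mult_right_mono) auto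
    then have "(r (Suc k))\<^sup>2 \<le> (r k)\<^sup>2" using decr[of k] by simp
    then show ?case using Suc r0[of k] by (meson order_trans power2_le_imp_le)
  qed simp
  obtain c where c: "0 \<le> c" and est: "\<And>k t. 0 \<le> t \<Longrightarrow> t \<le> 1 \<Longrightarrow>
      norm (g (y k + t *\<^sub>R d k) - b) \<le> (1 - t) * r k + c * t\<^sup>2 * (r k)\<^sup>2"
    using newton_residual_estimate[OF y0 r0[of 0]] yF r_le d unfolding r_def by metis
  have accept: "\<rho> ^ i \<in> armijo_steps \<sigma> \<rho> (y k) (d k)" if "c * r k * \<rho> ^ i \<le> 1 - 2 * \<sigma>" for i k
  proof -
    have "(norm (g (y k + \<rho> ^ i *\<^sub>R d k) - b))\<^sup>2 \<le> (1 - 2 * \<sigma> * \<rho> ^ i) * (r k)\<^sup>2"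
      using pow[of i] \<sigma> c r0[of k] that
      by (intro armijo_condition[where c = c] est) auto
    then show ?thesis
      using newton_step_feasible[OF yF d, of "\<rho> ^ i" k] pow[of i]
      by (auto simp: armijo_steps_def r_def)
  qed

  \<comment> \<open>The accepted steps are bounded below, so the residuals tend to zero.\<close>
  have cr: "0 < c * r 0 + 1" using mult_nonneg_nonneg[OF c r0[of 0]] by simp
  obtain i0 where i0: "\<rho> ^ i0 < (1 - 2 * \<sigma>) / (c * r 0 + 1)"
    using real_arch_pow_inv[of "(1 - 2 * \<sigma>) / (c * r 0 + 1)" \<rho>] \<sigma> \<rho> cr by auto
  have \<alpha>_ge: "\<rho> ^ i0 \<le> \<alpha> k" for k
  proof (rule max, rule accept)
    have "c * r k \<le> c * r 0 + 1"
      using mult_left_mono[OF r_le[of k] c] by simp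
    then have "c * r k * \<rho> ^ i0 \<le> (c * r 0 + 1) * \<rho> ^ i0"
      using pow by (intro mult_right_mono) (auto simp: less_imp_le)
    also have "\<dots> \<le> 1 - 2 * \<sigma>"
      using i0 cr by (simp add: less_divide_eq mult.commute)
    finally show "c * r k * \<rho> ^ i0 \<le> 1 - 2 * \<sigma>" .
  qed
  define q where "q = 1 - 2 * \<sigma> * \<rho> ^ i0"
  have q: "0 \<le> q" "q < 1"
    using \<sigma> pow[of i0] mult_mono[of "2 * \<sigma>" 1 "\<rho> ^ i0" 1] by (auto simp: q_def)
  have r_geom: "(r k)\<^sup>2 \<le> q ^ k * (r 0)\<^sup>2" for k
  proof (induction k)
    case (Suc k)
    have "(r (Suc k))\<^sup>2 \<le> q * (r k)\<^sup>2"
      using decr[of k] \<alpha>_ge[of k] \<sigma>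
      by (elim order_trans) (auto simp: q_def intro!: mult_right_mono)
    also have "\<dots> \<le> q * (q ^ k * (r 0)\<^sup>2)" using Suc q by (intro mult_left_mono)
    finally show ?case by (simp add: mult.assoc)
  qed simp
  have "(\<lambda>k. q ^ k * (r 0)\<^sup>2) \<longlonglongrightarrow> 0"
    using q by (intro tendsto_mult_left_zero LIMSEQ_power_zero) auto
  then have "(\<lambda>k. (r k)\<^sup>2) \<longlonglongrightarrow> 0"
    by (rule Lim_null_comparison[rotated]) (simp add: r_geom)
  then have "(\<lambda>k. sqrt ((r k)\<^sup>2)) \<longlonglongrightarrow> sqrt 0" by (rule tendsto_real_sqrt)
  then have r_lim: "r \<longlonglongrightarrow> 0" using r0 by simp

  \<comment> \<open>Eventually the full step is accepted, and then the residuals decrease quadratically.\<close>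
  have "(\<lambda>k. c * r k) \<longlonglongrightarrow> 0" using tendsto_mult_right_zero[OF r_lim] .
  then have "\<forall>\<^sub>F k in sequentially. c * r k < 1 - 2 * \<sigma>"
    using \<sigma> by (intro order_tendstoD) auto
  then have r_quad: "\<forall>\<^sub>F k in sequentially. r (Suc k) \<le> c * (r k)\<^sup>2"
  proof eventually_elim
    case (elim k)
    then have "1 \<le> \<alpha> k" using max[OF accept[of k 0]] by simp
    then have "\<alpha> k = 1" using \<alpha>01(2)[of k] by simp
    then show ?case using est[of 1 k] by (simp add: r_def next_y)
  qed

  \<comment> \<open>A limit point of the bounded sequence solves \<open>g w = b\<close>. The residuals control the distance to it.\<close>
  define U where "U = (1 + r 0 / bmin) / \<epsilon> * norm (y 0)"
  have "\<forall>k. y k \<in> cball 0 U"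
    using F_level_bound[OF yF y0 r_le[unfolded r_def]] by (simp add: U_def r_def)
  then obtain w h where h: "strict_mono h" "(y \<circ> h) \<longlonglongrightarrow> w"
    using compact_imp_seq_compact[OF compact_cball] unfolding seq_compact_def by metis
  have "(\<lambda>k. norm (g ((y \<circ> h) k) - b)) \<longlonglongrightarrow> 0"
    using LIMSEQ_subseq_LIMSEQ[OF r_lim h(1)] by (simp add: r_def o_def)
  then have w: "w \<in> F" and gw: "g w = b"
    using F_limit[OF _ h(2)] yF by auto
  have err: "norm (y k - w) \<le> norm w / bmin * r k" for k
    using error_le_residual[OF yF w gw, of k] by (simp add: r_def mult.commute)
  have "(\<lambda>k. norm w / bmin * r k) \<longlonglongrightarrow> 0" using tendsto_mult_right_zero[OF r_lim] .
  then have "(\<lambda>k. norm (y k - w)) \<longlonglongrightarrow> 0"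
    by (rule Lim_null_comparison[rotated]) (simp only: real_norm_def abs_norm_cancel err eventually_True)
  then have y_lim: "y \<longlonglongrightarrow> w" by (simp add: tendsto_norm_zero_iff LIM_zero_iff)

  obtain L \<delta> where L: "0 \<le> L" "0 < \<delta>"
    "\<And>z. norm (z - w) < \<delta> \<Longrightarrow> norm (g z - b) \<le> L * norm (z - w)"
    using residual_le_error[OF w gw] by blast
  have "\<forall>\<^sub>F k in sequentially. norm (y k - w) < \<delta>"
    using \<open>(\<lambda>k. norm (y k - w)) \<longlonglongrightarrow> 0\<close> L(2) by (rule order_tendstoD)
  with r_quad have "\<forall>\<^sub>F k in sequentially.
      norm (y (Suc k) - w) \<le> (norm w / bmin * (c * L\<^sup>2) + 1) * (norm (y k - w))\<^sup>2"
  proof eventually_elim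
    case (elim k)
    have "r k \<le> L * norm (y k - w)" using L(3)[OF elim(2)] by (simp add: r_def)
    then have "(r k)\<^sup>2 \<le> (L * norm (y k - w))\<^sup>2" using r0 by (intro power_mono)
    then have "c * (r k)\<^sup>2 \<le> c * (L * norm (y k - w))\<^sup>2" using c by (intro mult_left_mono)
    then have "r (Suc k) \<le> c * (L * norm (y k - w))\<^sup>2" using elim(1) by linarith
    then have "norm w / bmin * r (Suc k) \<le> norm w / bmin * (c * (L * norm (y k - w))\<^sup>2)"
      using bmin_pos by (intro mult_left_mono) auto
    with err[of "Suc k"]
    have "norm (y (Suc k) - w) \<le> norm w / bmin * (c * (L * norm (y k - w))\<^sup>2)" by linarith
    also have "\<dots> = norm w / bmin * (c * L\<^sup>2) * (norm (y k - w))\<^sup>2"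
      by (simp add: power_mult_distrib)
    also have "\<dots> \<le> (norm w / bmin * (c * L\<^sup>2) + 1) * (norm (y k - w))\<^sup>2"
      by (intro mult_right_mono) auto
    finally show ?case .
  qed
  moreover have "0 < norm w / bmin * (c * L\<^sup>2) + 1"
    using bmin_pos c by (intro add_nonneg_pos) auto
  ultimately show ?thesis using w gw y_lim by blast
qed

end

section \<open>The tensor formulation\<close>

lemma powr_inverse_power:
  assumes "0 < p" "0 \<le> (a :: real)"
  shows "(a powr (1 / real p)) ^ p = a"
proof (cases "a = 0")
  case False
  then show ?thesis using assms by (simp add: powr_realpow[symmetric] powr_powr)
qed (use assms in simp)

lemma vec_power_vec_powr:
  assumes "0 < p" "\<forall>i. 0 < y $ i"
  shows "vec_power (vec_powr y (1 / real p)) p = y"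
  using assms by (simp add: vec_power_def vec_powr_def vec_eq_iff powr_inverse_power less_imp_le)

lemma vec_powr_vec_power:
  assumes "0 < p" "\<forall>i. 0 < x $ i"
  shows "vec_powr (vec_power x p) (1 / real p) = x"
  using assms
  by (simp add: vec_power_def vec_powr_def vec_eq_iff powr_realpow[symmetric] powr_powr less_imp_le)

text \<open>
  Only the index \<open>js = replicate p i\<close> contributes to the identity part, where the geometric mean
  is \<open>y $ i\<close> itself.
\<close>
lemma (in nonneg_tensor) tensor_apply_eq_g:
  assumes A: "\<And>is. length is = Suc p \<Longrightarrow> A is = s * identity_tensor is - B is"
    and y: "\<forall>i. 0 \<le> y $ i"
  shows "tensor_apply (Suc p) A (vec_powr y (1 / real p)) = g y"
proof -
  have "tensor_apply (Suc p) A (vec_powr y (1 / real p)) $ i = s * y $ i - G y $ i" for i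
  proof -
    let ?J = "{js :: 'n list. length js = p}"
    have "tensor_apply (Suc p) A (vec_powr y (1 / real p)) $ i
        = (\<Sum>js\<in>?J. s * (identity_tensor (i # js) * gmean y js) - B (i # js) * gmean y js)"
      unfolding tensor_apply_def vec_powr_def gmean_def vec_lambda_beta
      by (intro sum.cong) (simp_all add: A algebra_simps)
    also have "\<dots> = s * (\<Sum>js\<in>?J. identity_tensor (i # js) * gmean y js) - G y $ i"
      by (simp add: sum_subtractf sum_distrib_left G_def)
    also have "(\<Sum>js\<in>?J. identity_tensor (i # js) * gmean y js)
        = (\<Sum>js\<in>?J. if js = replicate p i then gmean y js else 0)"
    proof (intro sum.cong refl)
      fix js :: "'n list" assume "js \<in> ?J"
      then have "(\<exists>k. i # js = replicate (Suc p) k) \<longleftrightarrow> js = replicate p i" by auto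
      then show "identity_tensor (i # js) * gmean y js = (if js = replicate p i then gmean y js else 0)"
        using \<open>js \<in> ?J\<close> by (simp add: identity_tensor_def)
    qed
    also have "\<dots> = gmean y (replicate p i)"
      by (simp add: sum.delta finite_lists_of_length)
    also have "\<dots> = y $ i"
      using p_pos y by (simp add: gmean_def powr_inverse_power)
    finally show ?thesis .
  qed
  then show ?thesis by (simp add: vec_eq_iff g_def)
qed

theorem theorem2p7:
  fixes m :: nat
    and A :: "(real, 'n::finite) tensor"
    and b :: "real ^ 'n"
    and \<epsilon> \<sigma> \<rho> :: real
    and y :: "nat \<Rightarrow> real ^ 'n"
  assumes "m \<ge> 2"
    and "semi_symmetric m A"
    and "strong_M_tensor m A"
    and "\<forall>i. b $ i > 0"
    and "0 < \<epsilon>" and "\<epsilon> < 1"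
    and "0 < \<sigma>" and "\<sigma> < 1 / 2"
    and "0 < \<rho>" and "\<rho> < 1"
    and "newton_sequence m A b \<epsilon> \<sigma> \<rho> y"
  shows "\<exists>x. positive_solution m A b x \<and>
           (\<forall>z. positive_solution m A b z \<longrightarrow> z = x) \<and>
           y \<longlonglongrightarrow> vec_power x (m - 1) \<and>
           (\<exists>C>0. \<forall>\<^sub>F k in sequentially.
              norm (y (Suc k) - vec_power x (m - 1)) \<le> C * (norm (y k - vec_power x (m - 1)))\<^sup>2)"
proof -
  define p where "p = m - 1"
  have m: "m = Suc p" and p: "0 < p" and mp: "real m - 1 = real p"
    using \<open>m \<ge> 2\<close> by (auto simp: p_def)
  obtain s B where A: "\<And>is. length is = Suc p \<Longrightarrow> A is = s * identity_tensor is - B is"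
    and B: "\<And>is. length is = Suc p \<Longrightarrow> 0 \<le> B is"
    using \<open>strong_M_tensor m A\<close> unfolding strong_M_tensor_def m by blast
  interpret newton_setting p B s b \<epsilon>
    using p B assms by unfold_locales auto
  have apply_eq: "tensor_apply m A (vec_powr z (1 / (real m - 1))) = g z" if "\<forall>i. 0 \<le> z $ i" for z
    using tensor_apply_eq_g[OF A that] by (simp add: m)
  have map_eq: "newton_map m A b z = g z - b" if "\<forall>i. 0 \<le> z $ i" for z
    using apply_eq[OF that] by (simp add: newton_map_def)
  have feas: "newton_feasible m A b \<epsilon> = F"
    by (auto simp: newton_feasible_def F_def less_eq_vec_def apply_eq)
  have F_nonneg: "\<forall>i. 0 \<le> z $ i" if "z \<in> F" for z
    using that by (simp add: F_def)
  have steps: "newton_steps m A b \<epsilon> \<sigma> \<rho> z d = armijo_steps \<sigma> \<rho> z d" if "z \<in> F" for z d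
    using that
    by (auto simp: newton_steps_def armijo_steps_def feas map_eq[OF F_nonneg])
  have jac: "jacobian (newton_map m A b) (at z) *v d = M z d" if z: "\<forall>i. 0 < z $ i" for z d
  proof -
    have "((\<lambda>z. g z - b) has_derivative M z) (at z)"
      using has_derivative_diff[OF g_has_derivative[OF z] has_derivative_const[of b]] by simp
    moreover have "open (\<Inter>i. {z :: real ^ 'n. 0 < z $ i})"
      by (intro open_INT ballI open_Collect_less continuous_intros finite)
    ultimately have der: "(newton_map m A b has_derivative M z) (at z)"
      using z by (elim has_derivative_transform_within_open) (auto simp: map_eq less_imp_le)
    then have "(newton_map m A b has_derivative (\<lambda>h. jacobian (newton_map m A b) (at z) *v h)) (at z)"
      using jacobian_works differentiableI by blast
    from has_derivative_unique[OF this der] show ?thesis by (rule fun_cong)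
  qed
  have y0: "y 0 \<in> F"
    using \<open>newton_sequence m A b \<epsilon> \<sigma> \<rho> y\<close> by (simp add: newton_sequence_def feas)
  have "\<exists>d \<alpha>. M (y k) d = b - g (y k) \<and>
      \<alpha> \<in> armijo_steps \<sigma> \<rho> (y k) d \<and> (\<forall>\<beta>\<in>armijo_steps \<sigma> \<rho> (y k) d. \<beta> \<le> \<alpha>) \<and>
      y (Suc k) = y k + \<alpha> *\<^sub>R d" if yk: "y k \<in> F" for k
  proof -
    obtain d \<alpha> where eq: "jacobian (newton_map m A b) (at (y k)) *v d + newton_map m A b (y k) = 0"
      and "\<alpha> \<in> newton_steps m A b \<epsilon> \<sigma> \<rho> (y k) d"
      and "\<forall>\<beta>\<in>newton_steps m A b \<epsilon> \<sigma> \<rho> (y k) d. \<beta> \<le> \<alpha>" and "y (Suc k) = y k + \<alpha> *\<^sub>R d"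
      using \<open>newton_sequence m A b \<epsilon> \<sigma> \<rho> y\<close> unfolding newton_sequence_def by blast
    moreover have "M (y k) d = b - g (y k)"
      using eq jac[OF F_pos[OF yk], of d] map_eq[OF F_nonneg[OF yk]]
      by (simp add: eq_neg_iff_add_eq_0[symmetric])
    ultimately show ?thesis
      using steps[OF yk, of d] by metis
  qed
  then obtain w where w: "w \<in> F" "g w = b" and lim: "y \<longlonglongrightarrow> w"
    and quad: "\<exists>C>0. \<forall>\<^sub>F k in sequentially. norm (y (Suc k) - w) \<le> C * (norm (y k - w))\<^sup>2"
    using newton_converges_quadratically[of \<sigma> \<rho> y] assms y0 by auto
  define x where "x = vec_powr w (1 / real p)"
  have xw: "vec_power x (m - 1) = w"
    using vec_power_vec_powr[OF p F_pos[OF w(1)]] by (simp add: x_def m)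
  have "0 < x $ i" for i
    using spec[OF F_pos[OF w(1)], of i] by (simp add: x_def vec_powr_def)
  then have sol: "positive_solution m A b x"
    using apply_eq[OF F_nonneg[OF w(1)]] w(2)
    by (simp add: positive_solution_def x_def mp)
  have uniq: "z = x" if "positive_solution m A b z" for z
  proof -
    have z: "\<forall>i. 0 < z $ i" "tensor_apply m A z = b"
      using that by (auto simp: positive_solution_def)
    define v where "v = vec_power z p"
    have zv: "vec_powr v (1 / real p) = z"
      using vec_powr_vec_power[OF p z(1)] by (simp add: v_def)
    have v: "\<forall>i. 0 < v $ i" using z(1) by (simp add: v_def vec_power_def)
    have gv: "g v = b"
      using apply_eq[of v] v z(2) by (simp add: mp zv less_imp_le)
    have "v \<in> F"
      using v assms by (simp add: F_def gv less_imp_le mult_le_cancel_right1)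
    from error_le_residual[OF this w] have "v = w" by (simp add: gv)
    then show ?thesis using zv by (simp add: x_def)
  qed
  show ?thesis
    by (rule exI[of _ x], unfold xw, intro conjI allI impI sol uniq lim quad)
qed

end
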